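(* Let $\gamma:\mathbb{S}^1\to\mathbb{R}^2$ be an $\ell$-convex Legendre curve with algebraic length $L$ and algebraic area $A$. Then for every real $\xi\le 24$, $$\int_0^{2\pi}\beta_\theta^2\,d\theta\ \ge\ \xi\left(\frac{L^2}{4\pi}-A\right),$$ and equality holds if $\gamma$ is a circle. Moreover, for any $\xi<24$, if equality holds then $\gamma$ is a circle; and for $\xi=24$, equality holds if and only if the support function of $\gamma$ is of the form $$p(\theta)=a_0+a_1\cos\theta+b_1\sin\theta+a_2\cos2\theta+b_2\sin2\theta$$ for some real constants $a_0,a_1,b_1,a_2,b_2$.
   Context: $\mathbb{S}^1=\mathbb{R}/2\pi\mathbb{Z}$; all maps are smooth; $\beta_\theta=d\beta/d\theta$. A closed Legendre curve is a smooth map $\gamma:\mathbb{S}^1\to\mathbb{R}^2$ with a smooth unit vector field $\nu$ along it satisfying $\langle\gamma',\nu\rangle=0$; with $\mu=J\nu$ ($J$ = counterclockwise rotation by $\pi/2$), put $\ell=\langle\nu',\mu\rangle$ and $\gamma'=\beta\mu$. It is $\ell$-convex if $\ell>0$. Convention: such curves are parametrized so that $\ell\equiv1$, $\nu(\theta)=(\cos\theta,\sin\theta)$; then $\gamma(\theta)=p(\theta)(\cos\theta,\sin\theta)+p'(\theta)(-\sin\theta,\cos\theta)$ for a smooth $2\pi$-periodic support function $p$, and $\beta=p+p''$. The algebraic length and area are $L=\int_0^{2\pi}p\,d\theta=\int_0^{2\pi}\beta\,d\theta$ and $A=\frac12\int_0^{2\pi}p(p+p'')\,d\theta$. A circle is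 a curve with $p(\theta)=a_0+a_1\cos\theta+b_1\sin\theta$ (radius $|a_0|$; a point is regarded as a circle of radius $0$). *)

theory Defs
  imports "HOL-Analysis.Analysis"
begin

text \<open>A map on the circle R/2piZ is represented by a 2pi-periodic map on the real line.\<close>

definition smooth_fun :: "(real \<Rightarrow> 'a::real_normed_vector) \<Rightarrow> bool" where
  "smooth_fun f \<longleftrightarrow>
     (\<forall>n t. ((\<lambda>g s. vector_derivative g (at s)) ^^ n) f differentiable (at t))"

definition circle_map :: "(real \<Rightarrow> 'a::real_normed_vector) \<Rightarrow> bool" where
  "circle_map f \<longleftrightarrow> smooth_fun f \<and> (\<forall>t. f (t + 2 * pi) = f t)"

definition rot90 :: "real^2 \<Rightarrow> real^2" where
  "rot90 v = vector [- (v $ 2), v $ 1]"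

definition legendre_curve :: "(real \<Rightarrow> real^2) \<Rightarrow> (real \<Rightarrow> real^2) \<Rightarrow> bool" where
  "legendre_curve \<gamma> \<nu> \<longleftrightarrow>
     circle_map \<gamma> \<and> circle_map \<nu> \<and>
     (\<forall>t. norm (\<nu> t) = 1) \<and>
     (\<forall>t. vector_derivative \<gamma> (at t) \<bullet> \<nu> t = 0)"

definition curv_ell :: "(real \<Rightarrow> real^2) \<Rightarrow> real \<Rightarrow> real" where
  "curv_ell \<nu> t = vector_derivative \<nu> (at t) \<bullet> rot90 (\<nu> t)"

text \<open>For a Legendre curve this is the unique function with \<open>\<gamma>' = \<beta> \<mu>\<close>, where \<open>\<mu> = J \<nu>\<close>;
  see \<open>legendre_curve_deriv\<close> below.\<close>

definition curv_beta :: "(real \<Rightarrow> real^2) \<Rightarrow> (real \<Rightarrow> real^2) \<Rightarrow> real \<Rightarrow> real" where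
  "curv_beta \<gamma> \<nu> t = vector_derivative \<gamma> (at t) \<bullet> rot90 (\<nu> t)"

definition ell_convex :: "(real \<Rightarrow> real^2) \<Rightarrow> (real \<Rightarrow> real^2) \<Rightarrow> bool" where
  "ell_convex \<gamma> \<nu> \<longleftrightarrow> legendre_curve \<gamma> \<nu> \<and> (\<forall>t. curv_ell \<nu> t > 0)"

text \<open>The second conjunct follows from the first (lemma \<open>curv_ell_normal_angle\<close>); it is kept
  because both are part of the usual convention.\<close>

definition normal_angle_param :: "(real \<Rightarrow> real^2) \<Rightarrow> bool" where
  "normal_angle_param \<nu> \<longleftrightarrow>
     (\<forall>\<theta>. \<nu> \<theta> = vector [cos \<theta>, sin \<theta>]) \<and> (\<forall>\<theta>. curv_ell \<nu> \<theta> = 1)"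

text \<open>In the normal angle parametrization this is the unique \<open>p\<close> with
  \<open>\<gamma> = p \<nu> + p' \<mu>\<close>, and \<open>\<beta> = p + p''\<close>; see \<open>support_fun_representation\<close> and
  \<open>curv_beta_support_fun\<close> below.\<close>

definition support_fun :: "(real \<Rightarrow> real^2) \<Rightarrow> (real \<Rightarrow> real^2) \<Rightarrow> real \<Rightarrow> real" where
  "support_fun \<gamma> \<nu> \<theta> = \<gamma> \<theta> \<bullet> \<nu> \<theta>"

text \<open>The next three notions are meant for curves in the normal angle parametrization.\<close>

definition alg_length :: "(real \<Rightarrow> real^2) \<Rightarrow> (real \<Rightarrow> real^2) \<Rightarrow> real" where
  "alg_length \<gamma> \<nu> = integral {0..2*pi} (support_fun \<gamma> \<nu>)"

definition alg_area :: "(real \<Rightarrow> real^2) \<Rightarrow> (real \<Rightarrow> real^2) \<Rightarrow> real" where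
  "alg_area \<gamma> \<nu> = 1/2 * integral {0..2*pi}
     (\<lambda>\<theta>. support_fun \<gamma> \<nu> \<theta> * (support_fun \<gamma> \<nu> \<theta> + deriv (deriv (support_fun \<gamma> \<nu>)) \<theta>))"

text \<open>Points are circles of radius 0, and \<open>a0\<close> may be negative.\<close>

definition is_circle :: "(real \<Rightarrow> real^2) \<Rightarrow> (real \<Rightarrow> real^2) \<Rightarrow> bool" where
  "is_circle \<gamma> \<nu> \<longleftrightarrow>
     (\<exists>a0 a1 b1. \<forall>\<theta>. support_fun \<gamma> \<nu> \<theta> = a0 + a1 * cos \<theta> + b1 * sin \<theta>)"

lemma legendre_curve_deriv:
  assumes "legendre_curve \<gamma> \<nu>"
  shows "vector_derivative \<gamma> (at t) = curv_beta \<gamma> \<nu> t *\<^sub>R rot90 (\<nu> t)"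
proof -
  define d where "d = vector_derivative \<gamma> (at t)"
  have n: "(\<nu> t $ 1)^2 + (\<nu> t $ 2)^2 = 1"
  proof -
    have "\<nu> t \<bullet> \<nu> t = 1"
      using assms by (simp add: legendre_curve_def flip: power2_norm_eq_inner)
    then show ?thesis by (simp add: inner_vec_def sum_2 power2_eq_square)
  qed
  have o: "d $ 1 * \<nu> t $ 1 + d $ 2 * \<nu> t $ 2 = 0"
    using assms by (simp add: legendre_curve_def d_def inner_vec_def sum_2)
  have 1: "d $ 1 = (- d $ 1 * \<nu> t $ 2 + d $ 2 * \<nu> t $ 1) * (- \<nu> t $ 2)"
    using n o by algebra
  have 2: "d $ 2 = (- d $ 1 * \<nu> t $ 2 + d $ 2 * \<nu> t $ 1) * (\<nu> t $ 1)"
    using n o by algebra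
  show ?thesis
    using 1 2 by (simp add: vec_eq_iff forall_2 curv_beta_def rot90_def inner_vec_def sum_2
        flip: d_def)
qed

lemma has_vector_derivative_normal:
  "((\<lambda>\<theta>. vector [cos \<theta>, sin \<theta>] :: real^2) has_vector_derivative vector [- sin \<theta>, cos \<theta>]) (at \<theta>)"
proof -
  have eq: "vector [x, y] = x *\<^sub>R axis 1 1 + y *\<^sub>R (axis 2 1 :: real^2)" for x y :: real
    by (simp add: vec_eq_iff forall_2 axis_def)
  show ?thesis
    unfolding eq by (auto intro!: derivative_eq_intros)
qed

lemma curv_ell_normal_angle:
  assumes "\<And>\<theta>. \<nu> \<theta> = vector [cos \<theta>, sin \<theta>]"
  shows "curv_ell \<nu> \<theta> = 1"
proof -
  have "vector_derivative \<nu> (at \<theta>) = vector [- sin \<theta>, cos \<theta>]"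
    using has_vector_derivative_normal[of \<theta>] assms
    by (metis (no_types, lifting) ext vector_derivative_at)
  then show ?thesis
    using sin_cos_squared_add[of \<theta>]
    by (simp add: curv_ell_def rot90_def assms inner_vec_def sum_2 power2_eq_square)
qed

lemma smooth_fun_deriv:
  assumes "smooth_fun f"
  shows "(f has_vector_derivative vector_derivative f (at t)) (at t)"
  using assms[unfolded smooth_fun_def, rule_format, of 0 t]
  by (simp add: vector_derivative_works)

context
  fixes \<gamma> \<nu> :: "real \<Rightarrow> real^2"
  assumes legendre: "legendre_curve \<gamma> \<nu>" and normal: "normal_angle_param \<nu>"
begin

private lemma nu: "\<nu> \<theta> = vector [cos \<theta>, sin \<theta>]"
  using normal by (simp add: normal_angle_param_def)

private lemma nu_deriv: "(\<nu> has_vector_derivative rot90 (\<nu> \<theta>)) (at \<theta>)"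
  using has_vector_derivative_normal[of \<theta>] by (simp add: nu[abs_def] rot90_def)

private lemma mu_deriv: "((\<lambda>\<theta>. rot90 (\<nu> \<theta>)) has_vector_derivative - \<nu> \<theta>) (at \<theta>)"
proof -
  have eq: "vector [x, y] = x *\<^sub>R axis 1 1 + y *\<^sub>R (axis 2 1 :: real^2)" for x y :: real
    by (simp add: vec_eq_iff forall_2 axis_def)
  have "((\<lambda>\<theta>. vector [- sin \<theta>, cos \<theta>] :: real^2) has_vector_derivative - vector [cos \<theta>, sin \<theta>])
    (at \<theta>)"
    unfolding eq by (auto intro!: derivative_eq_intros)
  then show ?thesis
    by (simp add: nu rot90_def)
qed

private lemma gamma_deriv:
  "(\<gamma> has_vector_derivative curv_beta \<gamma> \<nu> \<theta> *\<^sub>R rot90 (\<nu> \<theta>)) (at \<theta>)"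
  using smooth_fun_deriv[of \<gamma> \<theta>] legendre
  by (simp add: legendre_curve_deriv[OF legendre] legendre_curve_def circle_map_def)

private lemma unit: "\<nu> \<theta> \<bullet> \<nu> \<theta> = 1" "rot90 (\<nu> \<theta>) \<bullet> rot90 (\<nu> \<theta>) = 1" "rot90 (\<nu> \<theta>) \<bullet> \<nu> \<theta> = 0"
  using sin_cos_squared_add[of \<theta>]
  by (simp_all add: nu rot90_def inner_vec_def sum_2 power2_eq_square)

lemma support_fun_deriv:
  "(support_fun \<gamma> \<nu> has_real_derivative \<gamma> \<theta> \<bullet> rot90 (\<nu> \<theta>)) (at \<theta>)"
  unfolding support_fun_def[abs_def] has_real_derivative_iff_has_vector_derivative
  using bounded_bilinear.has_vector_derivative[OF bounded_bilinear_inner gamma_deriv[of \<theta>] nu_deriv[of \<theta>]]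
  by (simp add: unit)

lemma support_fun_deriv2:
  "(deriv (support_fun \<gamma> \<nu>) has_real_derivative curv_beta \<gamma> \<nu> \<theta> - support_fun \<gamma> \<nu> \<theta>) (at \<theta>)"
proof -
  have "deriv (support_fun \<gamma> \<nu>) = (\<lambda>\<theta>. \<gamma> \<theta> \<bullet> rot90 (\<nu> \<theta>))"
    using support_fun_deriv DERIV_imp_deriv by blast
  then show ?thesis
    unfolding has_real_derivative_iff_has_vector_derivative support_fun_def
    using bounded_bilinear.has_vector_derivative[OF bounded_bilinear_inner gamma_deriv[of \<theta>] mu_deriv[of \<theta>]]
    by (simp add: unit)
qed

lemma support_fun_representation:
  "\<gamma> \<theta> = support_fun \<gamma> \<nu> \<theta> *\<^sub>R vector [cos \<theta>, sin \<theta>]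
        + deriv (support_fun \<gamma> \<nu>) \<theta> *\<^sub>R vector [- sin \<theta>, cos \<theta>]"
proof -
  have d: "deriv (support_fun \<gamma> \<nu>) \<theta> = \<gamma> \<theta> \<bullet> rot90 (\<nu> \<theta>)"
    using support_fun_deriv DERIV_imp_deriv by blast
  have c: "cos \<theta> * cos \<theta> + sin \<theta> * sin \<theta> = 1"
    using sin_cos_squared_add[of \<theta>] by (simp add: power2_eq_square)
  show ?thesis
    unfolding d support_fun_def
    by (simp add: vec_eq_iff forall_2 nu rot90_def inner_vec_def sum_2) (use c in algebra)
qed

lemma curv_beta_support_fun:
  "curv_beta \<gamma> \<nu> \<theta> = support_fun \<gamma> \<nu> \<theta> + deriv (deriv (support_fun \<gamma> \<nu>)) \<theta>"
  using DERIV_imp_deriv[OF support_fun_deriv2[of \<theta>]] by simp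

end

end

theory Submission
  imports Defs
begin

text \<open>
  Split off the Fourier modes \<open>0\<close> and \<open>1\<close> of the support function,
  \<open>p = a0 + a1 cos + b1 sin + r\<close>, and put \<open>Q(g) = \<integral> g'\<^sup>2 - 4 g\<^sup>2\<close>. With \<open>h = r'' + 4 r\<close>,
  integration by parts gives \<open>D = L\<^sup>2/(4\<pi>) - A = 1/2 \<integral> r'\<^sup>2 - r\<^sup>2\<close> and
  \<open>\<integral> \<beta>'\<^sup>2 - 24 D = Q(h) + 10 \<integral> h\<^sup>2 + 21 Q(r)\<close>.
  So everything follows from \<open>Q(g) \<ge> 0\<close> for \<open>g\<close> without modes \<open>0\<close> and \<open>1\<close>:
  \<open>D \<ge> 3/2 \<integral> r\<^sup>2\<close>, and equality for \<open>\<xi> = 24\<close> forces \<open>r'' = - 4 r\<close>.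
  No Fourier series are needed for \<open>Q(g) \<ge> 0\<close>: by the intermediate value theorem some
  \<open>c + A cos + B sin\<close> agrees with \<open>g\<close> at four points spaced by \<open>\<pi>/2\<close>. Subtracting it
  only decreases \<open>Q\<close>, and the Dirichlet case of Wirtinger's inequality applies on each of the
  four arcs.
\<close>

section \<open>Wirtinger's inequality on an interval with Dirichlet boundary values\<close>

text \<open>The integrand \<open>(g' + \<kappa> g T)\<^sup>2 - g'\<^sup>2 + \<kappa>\<^sup>2 g\<^sup>2\<close> with \<open>T = tan (\<kappa> (x - m))\<close> is the derivative of \<open>\<kappa> g\<^sup>2 T\<close>;
  strictness keeps \<open>T\<close> bounded on the closed interval.\<close>

lemma wirtinger_dirichlet_strict:
  fixes g g' :: "real \<Rightarrow> real"
  assumes der: "\<And>x. (g has_real_derivative g' x) (at x)"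
    and cont: "continuous_on UNIV g'"
    and "g a = 0" "g b = 0" "a \<le> b" "0 \<le> \<kappa>" "\<kappa> * (b - a) < pi"
  shows "\<kappa>\<^sup>2 * integral {a..b} (\<lambda>x. (g x)\<^sup>2) \<le> integral {a..b} (\<lambda>x. (g' x)\<^sup>2)"
proof -
  define m where "m = (a + b) / 2"
  define T where "T x = tan (\<kappa> * (x - m))" for x
  define G where "G x = \<kappa> * (g x)\<^sup>2 * T x" for x
  have cg: "continuous_on S g" for S
    using der by (meson DERIV_isCont continuous_at_imp_continuous_on)
  have cg': "continuous_on S g'" for S
    using cont continuous_on_subset by blast
  have pos: "cos (\<kappa> * (x - m)) > 0" if "x \<in> {a..b}" for x
  proof -
    have "\<bar>x - m\<bar> \<le> (b - a) / 2"
      using that by (auto simp: m_def field_simps abs_le_iff)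
    then have "\<kappa> * \<bar>x - m\<bar> \<le> \<kappa> * ((b - a) / 2)"
      by (rule mult_left_mono) fact
    then have "\<bar>\<kappa> * (x - m)\<bar> < pi / 2"
      using assms by (simp add: abs_mult)
    then show ?thesis
      by (intro cos_gt_zero_pi) (auto simp: abs_less_iff)
  qed
  have cT: "continuous_on {a..b} T"
    unfolding T_def[abs_def] using pos
    by (intro continuous_intros) (metis less_irrefl)
  have dG: "(G has_real_derivative
      (g' x + \<kappa> * g x * T x)\<^sup>2 - (g' x)\<^sup>2 + \<kappa>\<^sup>2 * (g x)\<^sup>2) (at x)"
    if "x \<in> {a..b}" for x
  proof -
    have c: "cos (\<kappa> * (x - m)) \<noteq> 0"
      using pos[OF that] by simp
    have "(T has_real_derivative inverse ((cos (\<kappa> * (x - m)))\<^sup>2) * \<kappa>) (at x)"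
      unfolding T_def[abs_def]
      by (rule derivative_eq_intros refl c | simp)+
    then have dT: "(T has_real_derivative (1 + (T x)\<^sup>2) * \<kappa>) (at x)"
      using tan_sec[OF c] by (simp add: T_def power_inverse)
    show ?thesis
      unfolding G_def[abs_def]
      by (rule derivative_eq_intros dT der refl)+ (simp add: power2_eq_square algebra_simps)
  qed
  have "((\<lambda>x. (g' x + \<kappa> * g x * T x)\<^sup>2 - (g' x)\<^sup>2 + \<kappa>\<^sup>2 * (g x)\<^sup>2)
      has_integral G b - G a) {a..b}"
    using dG \<open>a \<le> b\<close>
    by (intro fundamental_theorem_of_calculus)
      (auto simp: has_real_derivative_iff_has_vector_derivative
        intro: has_vector_derivative_at_within)
  then have "0 = integral {a..b} (\<lambda>x. (g' x + \<kappa> * g x * T x)\<^sup>2 - (g' x)\<^sup>2 + \<kappa>\<^sup>2 * (g x)\<^sup>2)"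
    by (simp add: G_def assms integral_unique)
  also have "\<dots> = integral {a..b} (\<lambda>x. (g' x + \<kappa> * g x * T x)\<^sup>2)
      - integral {a..b} (\<lambda>x. (g' x)\<^sup>2) + \<kappa>\<^sup>2 * integral {a..b} (\<lambda>x. (g x)\<^sup>2)"
    by (subst integral_add integral_diff,
        (intro integrable_continuous_interval continuous_intros cg cg' cT)+)+ simp
  finally have "0 = integral {a..b} (\<lambda>x. (g' x + \<kappa> * g x * T x)\<^sup>2)
      - integral {a..b} (\<lambda>x. (g' x)\<^sup>2) + \<kappa>\<^sup>2 * integral {a..b} (\<lambda>x. (g x)\<^sup>2)" .
  moreover have "0 \<le> integral {a..b} (\<lambda>x. (g' x + \<kappa> * g x * T x)\<^sup>2)"
    by (intro integral_nonneg integrable_continuous_interval continuous_intros cg cg' cT) simp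
  ultimately show ?thesis
    by linarith
qed

text \<open>The borderline case \<open>\<kappa> * (b - a) = pi\<close> is a limit of the strict one:
  for \<open>0 < z < 1\<close> the strict version applies with \<open>sqrt z * \<kappa>\<close>,
  which yields the inequality with the extra factor \<open>z\<close>, and then \<open>z\<close>
  tends to 1.\<close>

lemma wirtinger_dirichlet:
  fixes g g' :: "real \<Rightarrow> real"
  assumes der: "\<And>x. (g has_real_derivative g' x) (at x)"
    and cont: "continuous_on UNIV g'"
    and "g a = 0" "g b = 0" "a \<le> b" "0 \<le> \<kappa>" "\<kappa> * (b - a) \<le> pi"
  shows "\<kappa>\<^sup>2 * integral {a..b} (\<lambda>x. (g x)\<^sup>2) \<le> integral {a..b} (\<lambda>x. (g' x)\<^sup>2)"
proof (rule field_le_mult_one_interval)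
  fix z :: real assume z: "0 < z" "z < 1"
  have "sqrt z * (\<kappa> * (b - a)) \<le> sqrt z * pi"
    using assms z by (intro mult_left_mono) auto
  also have "\<dots> < pi"
    using z by simp
  finally have "(sqrt z * \<kappa>)\<^sup>2 * integral {a..b} (\<lambda>x. (g x)\<^sup>2) \<le> integral {a..b} (\<lambda>x. (g' x)\<^sup>2)"
    using assms z by (intro wirtinger_dirichlet_strict[OF der cont]) (auto simp: mult.assoc)
  then show "z * (\<kappa>\<^sup>2 * integral {a..b} (\<lambda>x. (g x)\<^sup>2)) \<le> integral {a..b} (\<lambda>x. (g' x)\<^sup>2)"
    using z by (simp add: power_mult_distrib mult.assoc)
qed

section \<open>Wirtinger's inequality on the circle for functions without the modes 0 and 1\<close>

lemma integral_period_shift: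
  fixes f :: "real \<Rightarrow> real"
  assumes cont: "continuous_on UNIV f" and per: "\<And>t. f (t + c) = f t"
    and "0 \<le> s" "s \<le> c"
  shows "integral {s..s + c} f = integral {0..c} f"
proof -
  have int: "f integrable_on {u..v}" for u v
    using cont by (intro integrable_continuous_interval) (blast intro: continuous_on_subset)
  have "integral {0..s} f = integral {0..s} (\<lambda>t. f (t + c))"
    by (simp add: per)
  also have "\<dots> = integral {c..s + c} f"
    using integral_shift[where a = 0 and b = s and c = c and f = f] continuous_on_subset[OF cont]
    by (simp add: o_def)
  finally have eq: "integral {0..s} f = integral {c..s + c} f" .
  have "integral {0..s} f + integral {s..c} f = integral {0..c} f"
    using assms by (intro Henstock_Kurzweil_Integration.integral_combine int) auto
  moreover have "integral {s..c} f + integral {c..s + c} f = integral {s..s + c} f"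
    using assms by (intro Henstock_Kurzweil_Integration.integral_combine int) auto
  ultimately show ?thesis
    using eq by simp
qed

lemma deriv_periodic:
  fixes f f' :: "real \<Rightarrow> real"
  assumes der: "\<And>t. (f has_real_derivative f' t) (at t)" and per: "\<And>t. f (t + c) = f t"
  shows "f' (t + c) = f' t"
proof -
  have "((\<lambda>t. f (t + c)) has_real_derivative f' (t + c)) (at t)"
    using der[of "t + c"] by (simp add: DERIV_shift)
  then show ?thesis
    using der[of t] by (simp add: per DERIV_unique)
qed

text \<open>Integration by parts over a period takes this form below: a primitive with equal end
  values is exhibited, so no boundary terms arise.\<close>

lemma has_integral_deriv_periodic:
  fixes F f :: "real \<Rightarrow> real"
  assumes "\<And>t. (F has_real_derivative f t) (at t)" "F (2 * pi) = F 0"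
  shows "(f has_integral 0) {0..2 * pi}"
  using fundamental_theorem_of_calculus[of 0 "2 * pi" F f] assms
  by (auto simp: has_real_derivative_iff_has_vector_derivative
      intro: has_vector_derivative_at_within)

text \<open>On an arc of length \<open>pi/2\<close> the Dirichlet constant is (pi / (pi/2))^2 = 4,
  which is also the sharp constant on the circle once modes 0 and 1 are absent. Hence nothing is
  lost by cutting the circle into four arcs, provided the zeros at the cut points come for
  free.\<close>

lemma wirtinger_order2:
  fixes f f' :: "real \<Rightarrow> real"
  assumes der: "\<And>t. (f has_real_derivative f' t) (at t)"
    and cont: "continuous_on UNIV f'"
    and per: "\<And>t. f (t + 2 * pi) = f t"
    and orth: "(f has_integral 0) {0..2 * pi}"
      "((\<lambda>t. f t * cos t) has_integral 0) {0..2 * pi}"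
      "((\<lambda>t. f t * sin t) has_integral 0) {0..2 * pi}"
  shows "4 * integral {0..2 * pi} (\<lambda>t. (f t)\<^sup>2) \<le> integral {0..2 * pi} (\<lambda>t. (f' t)\<^sup>2)"
proof -
  have cf: "continuous_on S f" for S
    using der by (meson DERIV_isCont continuous_at_imp_continuous_on)
  have cf': "continuous_on S f'" for S
    using cont continuous_on_subset by blast
  have per': "f' (t + 2 * pi) = f' t" for t
    using deriv_periodic[of f f', OF der per] .

  \<comment> \<open>Any c + A cos + B sin has the sum 2c over each antipodal pair, so its
    alternating sum over four points spaced by \<open>pi/2\<close> is 0. Thus
    \<open>\<Delta> s = 0\<close> is the one linear condition for three coefficients to match four
    values. A shift by \<open>pi/2\<close> flips the sign of \<open>\<Delta>\<close>, which gives a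
    zero in between.\<close>
  define \<Delta> where "\<Delta> s = f s - f (s + pi/2) + f (s + pi) - f (s + 3*pi/2)" for s
  have \<Delta>_shift: "\<Delta> (pi/2) = - \<Delta> 0"
    using per[of 0] by (simp add: \<Delta>_def)
  have "continuous_on {0..pi/2} \<Delta>"
    unfolding \<Delta>_def[abs_def]
    by (intro continuous_intros continuous_on_compose2[OF cf[of UNIV]]) auto
  then obtain s where s: "0 \<le> s" "s \<le> pi/2" "\<Delta> s = 0"
    using IVT'[of \<Delta> 0 0 "pi/2"] IVT2'[of \<Delta> "pi/2" 0 0] \<Delta>_shift
    by (cases "\<Delta> 0 \<le> 0") auto

  \<comment> \<open>The interpolant in coordinates centred at \<open>s\<close>: \<open>c\<close> is
    the mean over an antipodal pair, the same for both pairs by the choice of \<open>s\<close>, and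
    \<open>A\<close>, \<open>B\<close> are the half differences. \<open>v\<close> is the derivative
    of \<open>u\<close>.\<close>
  define c where "c = (f s + f (s + pi)) / 2"
  define A where "A = (f s - f (s + pi)) / 2"
  define B where "B = (f (s + pi/2) - f (s + 3*pi/2)) / 2"
  define u where "u t = A * cos (t - s) + B * sin (t - s)" for t
  define v where "v t = B * cos (t - s) - A * sin (t - s)" for t
  define g where "g t = f t - c - u t" for t
  define g' where "g' t = f' t - v t" for t
  have du: "(u has_real_derivative v t) (at t)" for t
    unfolding u_def[abs_def] v_def by (auto intro!: derivative_eq_intros)
  have dv: "(v has_real_derivative - u t) (at t)" for t
    unfolding v_def[abs_def] u_def by (auto intro!: derivative_eq_intros)
  have uv: "(u t)\<^sup>2 + (v t)\<^sup>2 = A\<^sup>2 + B\<^sup>2" for t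
  proof -
    have "(u t)\<^sup>2 + (v t)\<^sup>2 = (A\<^sup>2 + B\<^sup>2) * ((sin (t - s))\<^sup>2 + (cos (t - s))\<^sup>2)"
      unfolding u_def v_def by algebra
    then show ?thesis by simp
  qed
  have u_per: "u (t + 2 * pi) = u t" and v_per: "v (t + 2 * pi) = v t" for t
    using sin_periodic[of "t - s"] cos_periodic[of "t - s"]
    by (simp_all add: u_def v_def algebra_simps)
  have dg: "(g has_real_derivative g' t) (at t)" for t
    unfolding g_def[abs_def] g'_def by (auto intro!: derivative_eq_intros der du)
  have cv: "continuous_on S v" for S
    using dv by (meson DERIV_isCont continuous_at_imp_continuous_on)
  have cg': "continuous_on S g'" for S
    unfolding g'_def[abs_def] by (intro continuous_intros cf' cv)
  have cg: "continuous_on S g" for S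
    using dg by (meson DERIV_isCont continuous_at_imp_continuous_on)

  have "s + 3 * pi / 2 - s = 3 / 2 * pi"
    by simp
  then have trig_3pi2: "cos (s + 3 * pi / 2 - s) = 0" "sin (s + 3 * pi / 2 - s) = -1"
    using cos_3over2_pi sin_3over2_pi by metis+
  have zero: "g s = 0" "g (s + pi/2) = 0" "g (s + pi) = 0" "g (s + 3*pi/2) = 0"
    using s(3) unfolding g_def u_def trig_3pi2 by (simp_all add: c_def A_def B_def \<Delta>_def field_simps)
  have g_per: "g (t + 2*pi) = g t" "g' (t + 2*pi) = g' t" for t
    by (simp_all add: g_def g'_def per per' u_per v_per)
  have zero5: "g (s + 2*pi) = 0"
    using g_per zero by simp

  define q where "q t = (g' t)\<^sup>2 - 4 * (g t)\<^sup>2" for t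
  have cq: "continuous_on S q" for S
    unfolding q_def[abs_def] by (intro continuous_intros cg cg')
  have iq: "q integrable_on {a..b}" for a b
    by (intro integrable_continuous_interval cq)
  have piece: "0 \<le> integral {a..b} q" if "g a = 0" "g b = 0" "b = a + pi/2" for a b
  proof -
    have "integral {a..b} q = integral {a..b} (\<lambda>x. (g' x)\<^sup>2) - 4 * integral {a..b} (\<lambda>x. (g x)\<^sup>2)"
      unfolding q_def[abs_def]
      by (subst integral_diff,
          (intro integrable_continuous_interval continuous_intros cg cg')+) simp
    then show ?thesis
      using wirtinger_dirichlet[OF dg cg', of a b 2] that by simp
  qed
  have "integral {s..s + pi/2} q + integral {s + pi/2..s + pi} q = integral {s..s + pi} q"
    "integral {s..s + pi} q + integral {s + pi..s + 3*pi/2} q = integral {s..s + 3*pi/2} q"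
    "integral {s..s + 3*pi/2} q + integral {s + 3*pi/2..s + 2*pi} q = integral {s..s + 2*pi} q"
    by ((rule Henstock_Kurzweil_Integration.integral_combine; simp add: iq)+)
  then have "0 \<le> integral {s..s + 2*pi} q"
    using piece[OF zero(1,2)] piece[OF zero(2,3)] piece[OF zero(3,4)] piece[OF zero(4) zero5]
    by simp
  also have "\<dots> = integral {0..2*pi} q"
    using s by (intro integral_period_shift cq) (auto simp: q_def g_per)
  finally have q_nonneg: "0 \<le> integral {0..2*pi} q" .

  \<comment> \<open>\<open>S'\<close> collects the exact derivative hidden in the expansion of
    \<open>q\<close>: -2 f' v + 8 f u is (-2 f v)' + 6 f u, and v^2 - 4 u^2 is (5/2 u v)' minus 3/2
    (u^2 + v^2), where u^2 + v^2 is constant.\<close>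
  define S where "S t = 5/2 * u t * v t + 8 * c * v t - 2 * f t * v t" for t
  define S' where "S' t = 5/2 * ((v t)\<^sup>2 - (u t)\<^sup>2) - 8 * c * u t - 2 * f' t * v t + 2 * f t * u t" for t
  have "(S has_real_derivative S' t) (at t)" for t
    unfolding S_def[abs_def] S'_def
    by (rule derivative_eq_intros du dv der refl)+ (simp add: power2_eq_square algebra_simps)
  then have iS: "(S' has_integral 0) {0..2*pi}"
    by (rule has_integral_deriv_periodic)
      (use u_per[of 0] v_per[of 0] per[of 0] in \<open>simp add: S_def\<close>)
  \<comment> \<open>The orthogonality hypotheses concern the unshifted \<open>cos t\<close> and
    \<open>sin t\<close>, so \<open>u\<close> is rewritten in that basis. After integration only the
    constant \<open>k \<ge> 0\<close> is left of the correction, and it has the favourable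
    sign.\<close>
  define a where "a = A * cos s - B * sin s"
  define b where "b = A * sin s + B * cos s"
  have u_ab: "u t = a * cos t + b * sin t" for t
    by (simp add: u_def a_def b_def cos_diff sin_diff algebra_simps)
  define k where "k = 3/2 * (A\<^sup>2 + B\<^sup>2) + 4 * c\<^sup>2"
  have q_eq: "q t = ((f' t)\<^sup>2 - 4 * (f t)\<^sup>2) + 8 * c * f t
      + 6 * a * (f t * cos t) + 6 * b * (f t * sin t) - k + S' t" for t
  proof -
    have "q t = ((f' t)\<^sup>2 - 4 * (f t)\<^sup>2) + 8 * c * f t + 6 * f t * u t
        - (3/2 * ((u t)\<^sup>2 + (v t)\<^sup>2) + 4 * c\<^sup>2) + S' t"
      by (simp add: q_def g_def g'_def S'_def power2_eq_square algebra_simps)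
    then show ?thesis
      unfolding uv k_def by (simp add: u_ab algebra_simps)
  qed
  have i2: "(\<lambda>t. (f t)\<^sup>2) integrable_on {0..2*pi}" "(\<lambda>t. (f' t)\<^sup>2) integrable_on {0..2*pi}"
    by (intro integrable_continuous_interval continuous_intros cf cf')+
  have "(q has_integral
      (integral {0..2*pi} (\<lambda>t. (f' t)\<^sup>2) - 4 * integral {0..2*pi} (\<lambda>t. (f t)\<^sup>2)) + 8 * c * 0
      + 6 * a * 0 + 6 * b * 0 - (2*pi - 0) *\<^sub>R k + 0) {0..2*pi}"
    unfolding q_eq
    by (intro has_integral_add has_integral_diff has_integral_mult_right
        integrable_integral i2 orth iS has_integral_const_real)
      (use has_integral_const_real[of k 0 "2*pi"] in simp)
  then have "integral {0..2*pi} q = integral {0..2*pi} (\<lambda>t. (f' t)\<^sup>2)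
      - 4 * integral {0..2*pi} (\<lambda>t. (f t)\<^sup>2) - 2 * pi * k"
    by (simp add: integral_unique)
  moreover have "0 \<le> 2 * pi * k"
    by (simp add: k_def)
  ultimately show ?thesis
    using q_nonneg by linarith
qed

text \<open>Serves the equality cases: continuity gives vanishing on one period, and
  \<open>x\<close> is the representative of \<open>t\<close> there.\<close>

lemma integral_square_eq_0_periodic:
  fixes f :: "real \<Rightarrow> real"
  assumes "continuous_on UNIV f" "\<And>t. f (t + 2 * pi) = f t"
    and "integral {0..2 * pi} (\<lambda>t. (f t)\<^sup>2) \<le> 0"
  shows "f t = 0"
proof -
  interpret periodic_fun_simple f "2 * pi"
    by unfold_locales (rule assms)
  define x where "x = t - of_int \<lfloor>t / (2 * pi)\<rfloor> * (2 * pi)"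
  have cont: "continuous_on {0..2 * pi} (\<lambda>t. (f t)\<^sup>2)"
    using assms(1) by (intro continuous_intros) (rule continuous_on_subset, auto)
  have "0 \<le> integral {0..2 * pi} (\<lambda>t. (f t)\<^sup>2)"
    by (intro integral_nonneg integrable_continuous_interval cont) simp
  then have "integral {0..2 * pi} (\<lambda>t. (f t)\<^sup>2) = 0"
    using assms(3) by simp
  then have "\<forall>x\<in>{0..2 * pi}. (f x)\<^sup>2 = 0"
    using integral_eq_0_iff[OF cont] by simp
  moreover have "x \<in> {0..2 * pi}"
    using floor_divide_lower[of "2 * pi" t] floor_divide_upper[of "2 * pi" t]
    by (simp add: x_def algebra_simps)
  ultimately have "f x = 0"
    by simp
  then show ?thesis
    by (simp add: x_def minus_of_int)
qed

section \<open>Periodic functions with three derivatives: residual and energy identity\<close>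

definition low_mode_free :: "(real \<Rightarrow> real) \<Rightarrow> bool" where
  "low_mode_free f \<longleftrightarrow>
     (f has_integral 0) {0..2 * pi} \<and>
     ((\<lambda>t. f t * cos t) has_integral 0) {0..2 * pi} \<and>
     ((\<lambda>t. f t * sin t) has_integral 0) {0..2 * pi}"

text \<open>The derivatives are parameters, so that the locale can be instantiated both with the
  support function and with its remainder after removal of modes 0 and 1. Periodicity of the
  derivatives is inherited from that of \<open>f\<close>.\<close>

locale periodic_C3 =
  fixes f f1 f2 f3 :: "real \<Rightarrow> real"
  assumes d0: "\<And>t. (f has_real_derivative f1 t) (at t)"
    and d1: "\<And>t. (f1 has_real_derivative f2 t) (at t)"
    and d2: "\<And>t. (f2 has_real_derivative f3 t) (at t)"
    and cont3: "continuous_on UNIV f3"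
    and per0: "\<And>t. f (t + 2 * pi) = f t"
begin

lemma per1: "f1 (t + 2 * pi) = f1 t"
  using deriv_periodic[of f f1, OF d0 per0] .

lemma per2: "f2 (t + 2 * pi) = f2 t"
  using deriv_periodic[of f1 f2, OF d1 per1] .

lemma cont: "continuous_on S f" "continuous_on S f1" "continuous_on S f2" "continuous_on S f3"
  by (rule DERIV_continuous_on, rule DERIV_subset[OF _ subset_UNIV], rule d0 d1 d2)+
    (rule continuous_on_subset[OF cont3 subset_UNIV])

lemma endpoints: "f (2 * pi) = f 0" "f1 (2 * pi) = f1 0" "f2 (2 * pi) = f2 0"
  using per0[of 0] per1[of 0] per2[of 0] by simp_all

text \<open>For a support function \<open>f\<close>, \<open>f1 + f3\<close> is the derivative of
  \<beta> = f + f''.\<close>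

definition energy :: real where
  "energy = integral {0..2 * pi} (\<lambda>t. (f1 t + f3 t)\<^sup>2)"

text \<open>The isoperimetric deficit L^2/(4 pi) - A of the curve with support function
  \<open>f\<close>.\<close>

definition deficit :: real where
  "deficit = (integral {0..2 * pi} f)\<^sup>2 / (4 * pi)
     - 1/2 * integral {0..2 * pi} (\<lambda>t. f t * (f t + f2 t))"

text \<open>On mode n the operator f'' + 4 f is multiplication by 4 - n^2, so it creates no new
  modes. Concretely, (f'' + f) cos and (f'' + f) sin are exact derivatives, and 3 f cos and 3 f sin
  remain.\<close>

lemma low_mode_free_residual:
  assumes "low_mode_free f"
  shows "low_mode_free (\<lambda>t. f2 t + 4 * f t)"
proof -
  have "(f2 has_integral 0) {0..2 * pi}"
    by (rule has_integral_deriv_periodic[OF d1]) (rule endpoints)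
  then have 0: "((\<lambda>t. f2 t + 4 * f t) has_integral 0 + 4 * 0) {0..2 * pi}"
    using assms unfolding low_mode_free_def
    by (intro has_integral_add has_integral_mult_right) auto
  have "((\<lambda>t. f1 t * cos t + f t * sin t) has_real_derivative f2 t * cos t + f t * cos t) (at t)" for t
    by (rule derivative_eq_intros d1 d0 refl)+ (simp add: algebra_simps)
  then have "((\<lambda>t. f2 t * cos t + f t * cos t) has_integral 0) {0..2 * pi}"
    by (rule has_integral_deriv_periodic) (simp add: endpoints)
  then have 1: "((\<lambda>t. (f2 t * cos t + f t * cos t) + 3 * (f t * cos t)) has_integral 0 + 3 * 0) {0..2 * pi}"
    using assms unfolding low_mode_free_def
    by (intro has_integral_add has_integral_mult_right) auto
  have "((\<lambda>t. f1 t * sin t - f t * cos t) has_real_derivative f2 t * sin t + f t * sin t) (at t)" for t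
    by (rule derivative_eq_intros d1 d0 refl)+ (simp add: algebra_simps)
  then have "((\<lambda>t. f2 t * sin t + f t * sin t) has_integral 0) {0..2 * pi}"
    by (rule has_integral_deriv_periodic) (simp add: endpoints)
  then have 2: "((\<lambda>t. (f2 t * sin t + f t * sin t) + 3 * (f t * sin t)) has_integral 0 + 3 * 0) {0..2 * pi}"
    using assms unfolding low_mode_free_def
    by (intro has_integral_add has_integral_mult_right) auto
  show ?thesis
    using 0 1 2 by (simp add: low_mode_free_def algebra_simps)
qed

text \<open>Under the equation f'' = -4 f, each of f, f cos and f sin is itself the derivative of a
  periodic function; for instance (f' cos + f sin)' = (f'' + f) cos = -3 f cos.\<close>

lemma low_mode_free_second_mode:
  assumes "\<And>t. f2 t = - 4 * f t"
  shows "low_mode_free f"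
proof -
  have "((\<lambda>t. - f1 t / 4) has_real_derivative f t) (at t)" for t
    by (rule derivative_eq_intros d1 refl)+ (simp_all add: assms)
  then have 0: "(f has_integral 0) {0..2 * pi}"
    by (rule has_integral_deriv_periodic) (simp add: endpoints)
  have "((\<lambda>t. - (f1 t * cos t + f t * sin t) / 3) has_real_derivative f t * cos t) (at t)" for t
    by (rule derivative_eq_intros d1 d0 refl)+ (simp_all add: assms algebra_simps)
  then have 1: "((\<lambda>t. f t * cos t) has_integral 0) {0..2 * pi}"
    by (rule has_integral_deriv_periodic) (simp add: endpoints)
  have "((\<lambda>t. - (f1 t * sin t - f t * cos t) / 3) has_real_derivative f t * sin t) (at t)" for t
    by (rule derivative_eq_intros d1 d0 refl)+ (simp_all add: assms algebra_simps)
  then have 2: "((\<lambda>t. f t * sin t) has_integral 0) {0..2 * pi}"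
    by (rule has_integral_deriv_periodic) (simp add: endpoints)
  show ?thesis
    using 0 1 2 by (simp add: low_mode_free_def)
qed

lemma wirtinger:
  assumes "low_mode_free f"
  shows "4 * integral {0..2 * pi} (\<lambda>t. (f t)\<^sup>2) \<le> integral {0..2 * pi} (\<lambda>t. (f1 t)\<^sup>2)"
  using assms wirtinger_order2[OF d0 cont(2) per0] by (simp add: low_mode_free_def)

lemma wirtinger_residual:
  assumes "low_mode_free f"
  shows "4 * integral {0..2 * pi} (\<lambda>t. (f2 t + 4 * f t)\<^sup>2)
    \<le> integral {0..2 * pi} (\<lambda>t. (f3 t + 4 * f1 t)\<^sup>2)"
proof (rule wirtinger_order2)
  show "((\<lambda>t. f2 t + 4 * f t) has_real_derivative f3 t + 4 * f1 t) (at t)" for t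
    by (auto intro!: derivative_eq_intros d0 d2)
  show "continuous_on UNIV (\<lambda>t. f3 t + 4 * f1 t)"
    by (intro continuous_intros cont)
qed (use low_mode_free_residual[OF assms] in \<open>simp_all add: low_mode_free_def per0 per2\<close>)

text \<open>On the Fourier mode \<open>n\<close>, with \<open>y = n\<^sup>2 - 4\<close>, this is
  \<open>y (y + 3) (y + 7) = y\<^sup>3 + 10 y\<^sup>2 + 21 y\<close>.\<close>

lemma energy_identity:
  "energy - 12 * (integral {0..2 * pi} (\<lambda>t. (f1 t)\<^sup>2) - integral {0..2 * pi} (\<lambda>t. (f t)\<^sup>2))
   = (integral {0..2 * pi} (\<lambda>t. (f3 t + 4 * f1 t)\<^sup>2)
        - 4 * integral {0..2 * pi} (\<lambda>t. (f2 t + 4 * f t)\<^sup>2))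
     + 10 * integral {0..2 * pi} (\<lambda>t. (f2 t + 4 * f t)\<^sup>2)
     + 21 * (integral {0..2 * pi} (\<lambda>t. (f1 t)\<^sup>2) - 4 * integral {0..2 * pi} (\<lambda>t. (f t)\<^sup>2))"
proof -
  \<comment> \<open>The pointwise discrepancy between the two sides, with 12 (f1^2 - f^2) moved to
    the right, is exactly (6 f1 f2 + 48 f f1)'.\<close>
  define F' where "F' t = 6 * (f2 t * f2 t + f1 t * f3 t) + 48 * (f1 t * f1 t + f t * f2 t)" for t
  have "((\<lambda>t. 6 * (f1 t * f2 t) + 48 * (f t * f1 t)) has_real_derivative F' t) (at t)" for t
    unfolding F'_def by (rule derivative_eq_intros d0 d1 d2 refl)+ (simp add: algebra_simps)
  then have F: "(F' has_integral 0) {0..2 * pi}"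
    by (rule has_integral_deriv_periodic) (simp add: endpoints)
  note int = integrable_integral[OF integrable_continuous_interval]
  have "((\<lambda>t. ((f3 t + 4 * f1 t)\<^sup>2 - 4 * (f2 t + 4 * f t)\<^sup>2) + 10 * (f2 t + 4 * f t)\<^sup>2
      + 21 * ((f1 t)\<^sup>2 - 4 * (f t)\<^sup>2) - F' t + 12 * ((f1 t)\<^sup>2 - (f t)\<^sup>2)) has_integral
    (integral {0..2 * pi} (\<lambda>t. (f3 t + 4 * f1 t)\<^sup>2)
        - 4 * integral {0..2 * pi} (\<lambda>t. (f2 t + 4 * f t)\<^sup>2))
     + 10 * integral {0..2 * pi} (\<lambda>t. (f2 t + 4 * f t)\<^sup>2)
     + 21 * (integral {0..2 * pi} (\<lambda>t. (f1 t)\<^sup>2) - 4 * integral {0..2 * pi} (\<lambda>t. (f t)\<^sup>2))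
     - 0 + 12 * (integral {0..2 * pi} (\<lambda>t. (f1 t)\<^sup>2) - integral {0..2 * pi} (\<lambda>t. (f t)\<^sup>2))) {0..2 * pi}"
    by (intro has_integral_add has_integral_diff has_integral_mult_right F int
        continuous_intros cont)
  moreover have "((f3 t + 4 * f1 t)\<^sup>2 - 4 * (f2 t + 4 * f t)\<^sup>2) + 10 * (f2 t + 4 * f t)\<^sup>2
      + 21 * ((f1 t)\<^sup>2 - 4 * (f t)\<^sup>2) - F' t + 12 * ((f1 t)\<^sup>2 - (f t)\<^sup>2) = (f1 t + f3 t)\<^sup>2" for t
    by (simp add: F'_def power2_eq_square algebra_simps)
  ultimately have "((\<lambda>t. (f1 t + f3 t)\<^sup>2) has_integral
    (integral {0..2 * pi} (\<lambda>t. (f3 t + 4 * f1 t)\<^sup>2)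
        - 4 * integral {0..2 * pi} (\<lambda>t. (f2 t + 4 * f t)\<^sup>2))
     + 10 * integral {0..2 * pi} (\<lambda>t. (f2 t + 4 * f t)\<^sup>2)
     + 21 * (integral {0..2 * pi} (\<lambda>t. (f1 t)\<^sup>2) - 4 * integral {0..2 * pi} (\<lambda>t. (f t)\<^sup>2))
     - 0 + 12 * (integral {0..2 * pi} (\<lambda>t. (f1 t)\<^sup>2) - integral {0..2 * pi} (\<lambda>t. (f t)\<^sup>2))) {0..2 * pi}"
    by simp
  then show ?thesis
    unfolding energy_def by (simp add: integral_unique)
qed

text \<open>Uniqueness by conservation of energy: the difference \<open>w\<close> from the candidate
  solves the same equation with zero initial data, so w'^2 + 4 w^2 is constantly 0.\<close>

lemma second_mode_solution:
  assumes "\<And>t. f2 t = - 4 * f t"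
  shows "f t = f 0 * cos (2 * t) + f1 0 / 2 * sin (2 * t)"
proof -
  define w where "w t = f t - f 0 * cos (2 * t) - f1 0 / 2 * sin (2 * t)" for t
  define w1 where "w1 t = f1 t + 2 * f 0 * sin (2 * t) - f1 0 * cos (2 * t)" for t
  have w: "(w has_real_derivative w1 t) (at t)" for t
    unfolding w_def[abs_def] w1_def
    by (rule derivative_eq_intros d0 refl)+ simp
  have w1: "(w1 has_real_derivative - 4 * w t) (at t)" for t
    unfolding w1_def[abs_def] w_def
    by (rule derivative_eq_intros d1 refl)+ (simp_all add: assms)
  have "((\<lambda>t. (w1 t)\<^sup>2 + 4 * (w t)\<^sup>2) has_real_derivative 0) (at t)" for t
    by (rule derivative_eq_intros w w1 refl)+ simp
  then have "(w1 t)\<^sup>2 + 4 * (w t)\<^sup>2 = (w1 0)\<^sup>2 + 4 * (w 0)\<^sup>2"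
    using DERIV_isconst_all[of "\<lambda>t. (w1 t)\<^sup>2 + 4 * (w t)\<^sup>2" t 0] by blast
  then have "(w1 t)\<^sup>2 + 4 * (w t)\<^sup>2 = 0"
    by (simp add: w_def w1_def)
  then have "w t = 0"
    by (simp add: add_nonneg_eq_0_iff)
  then show ?thesis
    by (simp add: w_def)
qed

section \<open>Splitting off the Fourier modes 0 and 1\<close>

lemma remainder: "periodic_C3
    (\<lambda>t. f t - a0 - a1 * cos t - b1 * sin t) (\<lambda>t. f1 t + a1 * sin t - b1 * cos t)
    (\<lambda>t. f2 t + a1 * cos t + b1 * sin t) (\<lambda>t. f3 t - a1 * sin t + b1 * cos t)"
  by unfold_locales
    (auto intro!: derivative_eq_intros continuous_intros d0 d1 d2 cont simp: per0)

lemma remainder_low_mode_free: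
  obtains a0 a1 b1 where "low_mode_free (\<lambda>t. f t - a0 - a1 * cos t - b1 * sin t)"
proof -
  define a0 where "a0 = integral {0..2 * pi} f / (2 * pi)"
  define a1 where "a1 = integral {0..2 * pi} (\<lambda>t. f t * cos t) / pi"
  define b1 where "b1 = integral {0..2 * pi} (\<lambda>t. f t * sin t) / pi"
  note int = integrable_integral[OF integrable_continuous_interval]
  have const: "((\<lambda>t. c) has_integral 2 * pi * c) {0..2 * pi}" for c :: real
    using has_integral_const_real[of c 0 "2 * pi"] by simp
  \<comment> \<open>Removing the mean 1/2 from cos^2 and sin^2 leaves functions with periodic
    primitives sin cos / 2 and - sin cos / 2.\<close>
  have half: "((cos t)\<^sup>2 - (sin t)\<^sup>2) / 2 = (cos t)\<^sup>2 - 1/2" "((sin t)\<^sup>2 - (cos t)\<^sup>2) / 2 = (sin t)\<^sup>2 - 1/2"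
    for t :: real
    by (simp_all add: sin_squared_eq field_simps)
  have eq1: "f t * cos t - a1 / 2 - (a0 * cos t + a1 * ((cos t)\<^sup>2 - 1/2) + b1 * (sin t * cos t))
      = (f t - a0 - a1 * cos t - b1 * sin t) * cos t"
    and eq2: "f t * sin t - b1 / 2 - (a0 * sin t + a1 * (sin t * cos t) + b1 * ((sin t)\<^sup>2 - 1/2))
      = (f t - a0 - a1 * cos t - b1 * sin t) * sin t" for t
    by (simp_all add: algebra_simps power2_eq_square)
  have "((\<lambda>t. a1 * sin t - b1 * cos t) has_real_derivative a1 * cos t + b1 * sin t) (at t)" for t
    by (auto intro!: derivative_eq_intros)
  then have "((\<lambda>t. a1 * cos t + b1 * sin t) has_integral 0) {0..2 * pi}"
    by (rule has_integral_deriv_periodic) simp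
  then have "((\<lambda>t. f t - a0 - (a1 * cos t + b1 * sin t)) has_integral
      integral {0..2 * pi} f - 2 * pi * a0 - 0) {0..2 * pi}"
    by (intro has_integral_diff const int cont)
  then have 0: "((\<lambda>t. f t - a0 - a1 * cos t - b1 * sin t) has_integral 0) {0..2 * pi}"
    by (simp add: a0_def algebra_simps)
  have "((\<lambda>t. a0 * sin t + a1 * (sin t * cos t) / 2 + b1 * (sin t)\<^sup>2 / 2) has_real_derivative
      a0 * cos t + a1 * (((cos t)\<^sup>2 - (sin t)\<^sup>2) / 2) + b1 * (sin t * cos t)) (at t)" for t
    by (auto intro!: derivative_eq_intros simp: power2_eq_square field_simps)
  then have "((\<lambda>t. a0 * cos t + a1 * ((cos t)\<^sup>2 - 1/2) + b1 * (sin t * cos t)) has_integral 0) {0..2 * pi}"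
    unfolding half
    by (rule has_integral_deriv_periodic) simp
  then have "((\<lambda>t. f t * cos t - a1 / 2 - (a0 * cos t + a1 * ((cos t)\<^sup>2 - 1/2) + b1 * (sin t * cos t)))
      has_integral integral {0..2 * pi} (\<lambda>t. f t * cos t) - 2 * pi * (a1 / 2) - 0) {0..2 * pi}"
    by (intro has_integral_diff const int cont continuous_intros)
  then have 1: "((\<lambda>t. (f t - a0 - a1 * cos t - b1 * sin t) * cos t) has_integral 0) {0..2 * pi}"
    unfolding eq1 by (simp add: a1_def)
  have "((\<lambda>t. - a0 * cos t + a1 * (sin t)\<^sup>2 / 2 - b1 * (sin t * cos t) / 2) has_real_derivative
      a0 * sin t + a1 * (sin t * cos t) + b1 * (((sin t)\<^sup>2 - (cos t)\<^sup>2) / 2)) (at t)" for t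
    by (auto intro!: derivative_eq_intros simp: power2_eq_square field_simps)
  then have "((\<lambda>t. a0 * sin t + a1 * (sin t * cos t) + b1 * ((sin t)\<^sup>2 - 1/2)) has_integral 0) {0..2 * pi}"
    unfolding half
    by (rule has_integral_deriv_periodic) simp
  then have "((\<lambda>t. f t * sin t - b1 / 2 - (a0 * sin t + a1 * (sin t * cos t) + b1 * ((sin t)\<^sup>2 - 1/2)))
      has_integral integral {0..2 * pi} (\<lambda>t. f t * sin t) - 2 * pi * (b1 / 2) - 0) {0..2 * pi}"
    by (intro has_integral_diff const int cont continuous_intros)
  then have 2: "((\<lambda>t. (f t - a0 - a1 * cos t - b1 * sin t) * sin t) has_integral 0) {0..2 * pi}"
    unfolding eq2 by (simp add: b1_def)
  show ?thesis
    using 0 1 2 that by (simp add: low_mode_free_def)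
qed

text \<open>The operator f + f'' kills cos and sin, and the constant \<open>a0\<close> contributes
  pi a0^2 to both L^2/(4 pi) and A. What survives is -1/2 times the integral of r (r + r''),
  integrated by parts.\<close>

lemma deficit_remainder:
  fixes a0 a1 b1
  defines "r \<equiv> \<lambda>t. f t - a0 - a1 * cos t - b1 * sin t"
    and "r1 \<equiv> \<lambda>t. f1 t + a1 * sin t - b1 * cos t"
  assumes "(r has_integral 0) {0..2 * pi}"
  shows "deficit =
    1/2 * (integral {0..2 * pi} (\<lambda>t. (r1 t)\<^sup>2) - integral {0..2 * pi} (\<lambda>t. (r t)\<^sup>2))"
proof -
  define w where "w t = a1 * cos t + b1 * sin t" for t
  define w1 where "w1 t = b1 * cos t - a1 * sin t" for t
  define r2 where "r2 = (\<lambda>t. f2 t + a1 * cos t + b1 * sin t)"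
  interpret r: periodic_C3 r r1 r2 "\<lambda>t. f3 t - a1 * sin t + b1 * cos t"
    unfolding r_def r1_def r2_def by (rule remainder)
  note int = integrable_integral[OF integrable_continuous_interval]
  have const: "((\<lambda>t. c) has_integral 2 * pi * c) {0..2 * pi}" for c :: real
    using has_integral_const_real[of c 0 "2 * pi"] by simp
  have dw: "(w has_real_derivative w1 t) (at t)" for t
    unfolding w_def[abs_def] w1_def by (auto intro!: derivative_eq_intros)
  have dw1: "(w1 has_real_derivative - w t) (at t)" for t
    unfolding w_def w1_def[abs_def] by (auto intro!: derivative_eq_intros)
  have w_ends: "w (2 * pi) = w 0" "w1 (2 * pi) = w1 0"
    by (simp_all add: w_def w1_def)
  have f: "f t = a0 + w t + r t" and f2: "f2 t = r2 t - w t" for t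
    by (simp_all add: r_def r2_def w_def)
  have "((\<lambda>t. - w t) has_integral 0) {0..2 * pi}"
    by (rule has_integral_deriv_periodic[OF dw1]) (rule w_ends)
  then have "((\<lambda>t. a0 - (- w t) + r t) has_integral 2 * pi * a0 - 0 + 0) {0..2 * pi}"
    by (intro has_integral_add has_integral_diff const assms)
  then have I: "integral {0..2 * pi} f = 2 * pi * a0"
    by (simp add: f[abs_def] integral_unique)
  \<comment> \<open>With f + f'' = a0 + r + r'', these are the terms of f (f + f'') that integrate
    to 0, plus r'^2 to complete r r'' to (r r')'. The pair w r'' + w r is (w r' - w' r)' because w''
    = -w.\<close>
  define F' where "F' t = a0 * r2 t + a0 * w t + (w t * r2 t + w t * r t) + (r1 t * r1 t + r t * r2 t)" for t
  have "((\<lambda>t. a0 * r1 t - a0 * w1 t + (w t * r1 t - w1 t * r t) + r t * r1 t)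
      has_real_derivative F' t) (at t)" for t
    unfolding F'_def
    by (rule derivative_eq_intros r.d0 r.d1 dw dw1 refl)+ (simp add: algebra_simps)
  then have F: "(F' has_integral 0) {0..2 * pi}"
    by (rule has_integral_deriv_periodic) (simp add: r.endpoints w_ends)
  have "((\<lambda>t. a0\<^sup>2 + 2 * a0 * r t + (r t)\<^sup>2 - (r1 t)\<^sup>2 + F' t) has_integral
      2 * pi * a0\<^sup>2 + 2 * a0 * 0 + integral {0..2 * pi} (\<lambda>t. (r t)\<^sup>2)
      - integral {0..2 * pi} (\<lambda>t. (r1 t)\<^sup>2) + 0) {0..2 * pi}"
    by (intro has_integral_add has_integral_diff has_integral_mult_right const F assms int
        continuous_intros r.cont)
  moreover have "a0\<^sup>2 + 2 * a0 * r t + (r t)\<^sup>2 - (r1 t)\<^sup>2 + F' t = f t * (f t + f2 t)" for t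
    unfolding F'_def f f2 by algebra
  ultimately have "integral {0..2 * pi} (\<lambda>t. f t * (f t + f2 t)) =
      2 * pi * a0\<^sup>2 + integral {0..2 * pi} (\<lambda>t. (r t)\<^sup>2) - integral {0..2 * pi} (\<lambda>t. (r1 t)\<^sup>2)"
    by (simp add: integral_unique)
  then show ?thesis
    unfolding deficit_def I by (simp add: power2_eq_square field_simps)
qed

section \<open>Quantitative bounds and the equality cases\<close>

text \<open>Both bounds refer to the same remainder \<open>r\<close>. The factor 3/2 is (4 - 1)/2,
  from Wirtinger's inequality inserted into the formula for the deficit.\<close>

lemma deficit_energy_bounds:
  obtains a0 a1 b1 r r1 r2 r3
  where "periodic_C3 r r1 r2 r3"
    and "\<And>t. f t = a0 + a1 * cos t + b1 * sin t + r t"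
    and "3/2 * integral {0..2 * pi} (\<lambda>t. (r t)\<^sup>2) \<le> deficit"
    and "10 * integral {0..2 * pi} (\<lambda>t. (r2 t + 4 * r t)\<^sup>2) \<le> energy - 24 * deficit"
proof -
  obtain a0 a1 b1 where low: "low_mode_free (\<lambda>t. f t - a0 - a1 * cos t - b1 * sin t)"
    by (rule remainder_low_mode_free)
  define r where "r = (\<lambda>t. f t - a0 - a1 * cos t - b1 * sin t)"
  define r1 where "r1 = (\<lambda>t. f1 t + a1 * sin t - b1 * cos t)"
  define r2 where "r2 = (\<lambda>t. f2 t + a1 * cos t + b1 * sin t)"
  define r3 where "r3 = (\<lambda>t. f3 t - a1 * sin t + b1 * cos t)"
  interpret r: periodic_C3 r r1 r2 r3
    unfolding r_def r1_def r2_def r3_def by (rule remainder)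
  have low: "low_mode_free r"
    using low by (simp add: r_def)
  have D: "deficit =
      1/2 * (integral {0..2 * pi} (\<lambda>t. (r1 t)\<^sup>2) - integral {0..2 * pi} (\<lambda>t. (r t)\<^sup>2))"
    using deficit_remainder[of a0 a1 b1] low by (simp add: low_mode_free_def r_def r1_def)
  \<comment> \<open>The expression f' + f''' is unchanged when constants, cos and sin are
    subtracted.\<close>
  have E: "energy = r.energy"
    unfolding energy_def r.energy_def by (simp add: r1_def r3_def)
  show ?thesis
  proof
    show "periodic_C3 r r1 r2 r3" ..
    show "f t = a0 + a1 * cos t + b1 * sin t + r t" for t
      by (simp add: r_def)
    show "3/2 * integral {0..2 * pi} (\<lambda>t. (r t)\<^sup>2) \<le> deficit"
      using D r.wirtinger[OF low] by simp
    show "10 * integral {0..2 * pi} (\<lambda>t. (r2 t + 4 * r t)\<^sup>2) \<le> energy - 24 * deficit"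
    proof -
      \<comment> \<open>The arithmetic core, with the integrals replaced by variables: the terms z -
        4 w and 21 (x - 4 y) of the energy identity are nonnegative by Wirtinger's inequality for
        the residual and for \<open>r\<close>, and are dropped.\<close>
      have "10 * w \<le> e - 24 * d"
        if "e - 12 * (x - y) = (z - 4 * w) + 10 * w + 21 * (x - 4 * y)" "d = 1/2 * (x - y)"
          "4 * y \<le> x" "4 * w \<le> z" for d e w x y z :: real
        using that by simp
      from this[OF r.energy_identity D r.wirtinger[OF low] r.wirtinger_residual[OF low]]
      show ?thesis
        by (simp only: E)
    qed
  qed
qed

lemma deficit_nonneg: "0 \<le> deficit"
proof -
  obtain a0 a1 b1 r r1 r2 r3 where "periodic_C3 r r1 r2 r3"
    and D: "3/2 * integral {0..2 * pi} (\<lambda>t. (r t)\<^sup>2) \<le> deficit"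
    by (rule deficit_energy_bounds) blast
  then interpret r: periodic_C3 r r1 r2 r3 by simp
  have "0 \<le> integral {0..2 * pi} (\<lambda>t. (r t)\<^sup>2)"
    by (intro integral_nonneg integrable_continuous_interval continuous_intros r.cont) simp
  then show ?thesis using D by simp
qed

lemma deficit_eq_0:
  assumes "deficit \<le> 0"
  shows "\<exists>a0 a1 b1. \<forall>t. f t = a0 + a1 * cos t + b1 * sin t"
proof -
  obtain a0 a1 b1 r r1 r2 r3 where "periodic_C3 r r1 r2 r3"
    and f: "\<And>t. f t = a0 + a1 * cos t + b1 * sin t + r t"
    and D: "3/2 * integral {0..2 * pi} (\<lambda>t. (r t)\<^sup>2) \<le> deficit"
    by (rule deficit_energy_bounds) blast
  then interpret r: periodic_C3 r r1 r2 r3 by simp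
  have "r t = 0" for t
    using D assms by (intro integral_square_eq_0_periodic r.cont r.per0) simp
  then show ?thesis using f by auto
qed

lemma energy_ge: "24 * deficit \<le> energy"
proof -
  obtain a0 a1 b1 r r1 r2 r3 where "periodic_C3 r r1 r2 r3"
    and E: "10 * integral {0..2 * pi} (\<lambda>t. (r2 t + 4 * r t)\<^sup>2) \<le> energy - 24 * deficit"
    by (rule deficit_energy_bounds) blast
  then interpret r: periodic_C3 r r1 r2 r3 by simp
  have "0 \<le> integral {0..2 * pi} (\<lambda>t. (r2 t + 4 * r t)\<^sup>2)"
    by (intro integral_nonneg integrable_continuous_interval continuous_intros r.cont) simp
  then show ?thesis using E by simp
qed

lemma energy_eq_imp:
  assumes "energy = 24 * deficit"
  shows "\<exists>a0 a1 b1 a2 b2. \<forall>t. f t = a0 + a1 * cos t + b1 * sin t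
    + a2 * cos (2 * t) + b2 * sin (2 * t)"
proof -
  obtain a0 a1 b1 r r1 r2 r3 where "periodic_C3 r r1 r2 r3"
    and f: "\<And>t. f t = a0 + a1 * cos t + b1 * sin t + r t"
    and E: "10 * integral {0..2 * pi} (\<lambda>t. (r2 t + 4 * r t)\<^sup>2) \<le> energy - 24 * deficit"
    by (rule deficit_energy_bounds) blast
  then interpret r: periodic_C3 r r1 r2 r3 by simp
  have "r2 t + 4 * r t = 0" for t
    using E assms
    by (intro integral_square_eq_0_periodic[of "\<lambda>t. r2 t + 4 * r t"] continuous_intros r.cont)
      (simp_all add: r.per0 r.per2)
  then have r2: "r2 t = - 4 * r t" for t
    by (simp add: add_eq_0_iff2)
  have "f t = a0 + a1 * cos t + b1 * sin t + r 0 * cos (2 * t) + r1 0 / 2 * sin (2 * t)" for t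
    using r.second_mode_solution[OF r2, of t] f[of t] by simp
  then show ?thesis by blast
qed

text \<open>For a pure second mode \<open>r\<close> the residual r'' + 4 r and its derivative
  vanish, and Wirtinger's inequality for \<open>r\<close> is an equality, so every term on the right
  of \<open>energy_identity\<close> is 0.\<close>

lemma energy_eq_second_mode:
  assumes f: "\<And>t. f t = a0 + a1 * cos t + b1 * sin t + a2 * cos (2 * t) + b2 * sin (2 * t)"
  shows "energy = 24 * deficit" and "a2 = 0 \<Longrightarrow> b2 = 0 \<Longrightarrow> deficit = 0"
proof -
  define r where "r = (\<lambda>t. f t - a0 - a1 * cos t - b1 * sin t)"
  define r1 where "r1 = (\<lambda>t. f1 t + a1 * sin t - b1 * cos t)"
  define r2 where "r2 = (\<lambda>t. f2 t + a1 * cos t + b1 * sin t)"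
  define r3 where "r3 = (\<lambda>t. f3 t - a1 * sin t + b1 * cos t)"
  interpret r: periodic_C3 r r1 r2 r3
    unfolding r_def r1_def r2_def r3_def by (rule remainder)
  have r: "r = (\<lambda>t. a2 * cos (2 * t) + b2 * sin (2 * t))"
    by (simp add: r_def f)
  have "(r has_real_derivative 2 * b2 * cos (2 * t) - 2 * a2 * sin (2 * t)) (at t)" for t
    unfolding r by (auto intro!: derivative_eq_intros)
  then have r1: "r1 = (\<lambda>t. 2 * b2 * cos (2 * t) - 2 * a2 * sin (2 * t))"
    using r.d0 DERIV_unique by blast
  have "(r1 has_real_derivative - 4 * r t) (at t)" for t
    unfolding r r1 by (auto intro!: derivative_eq_intros)
  then have r2: "r2 t = - 4 * r t" for t
    using r.d1 DERIV_unique by blast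
  have "(r2 has_real_derivative - 4 * r1 t) (at t)" for t
    unfolding r2[abs_def] by (auto intro!: derivative_eq_intros r.d0)
  then have r3: "r3 t = - 4 * r1 t" for t
    using r.d2 DERIV_unique by blast
  have low: "low_mode_free r"
    by (rule r.low_mode_free_second_mode) (rule r2)
  have D: "deficit =
      1/2 * (integral {0..2 * pi} (\<lambda>t. (r1 t)\<^sup>2) - integral {0..2 * pi} (\<lambda>t. (r t)\<^sup>2))"
    using deficit_remainder[of a0 a1 b1] low by (simp add: low_mode_free_def r_def r1_def)
  have E: "energy = r.energy"
    unfolding energy_def r.energy_def by (simp add: r1_def r3_def)
  \<comment> \<open>Equality in Wirtinger's inequality without evaluating either integral: r'^2 - 4
    r^2 is the derivative of r r'.\<close>
  have "((\<lambda>t. r t * r1 t) has_real_derivative (r1 t)\<^sup>2 - 4 * (r t)\<^sup>2) (at t)" for t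
    by (rule derivative_eq_intros r.d0 r.d1 refl)+ (simp add: r2 power2_eq_square)
  then have "((\<lambda>t. (r1 t)\<^sup>2 - 4 * (r t)\<^sup>2) has_integral 0) {0..2 * pi}"
    by (rule has_integral_deriv_periodic) (simp add: r.endpoints)
  moreover have "((\<lambda>t. (r1 t)\<^sup>2 - 4 * (r t)\<^sup>2) has_integral integral {0..2 * pi} (\<lambda>t. (r1 t)\<^sup>2)
      - 4 * integral {0..2 * pi} (\<lambda>t. (r t)\<^sup>2)) {0..2 * pi}"
    by (intro has_integral_diff has_integral_mult_right integrable_integral
        integrable_continuous_interval continuous_intros r.cont)
  ultimately have "integral {0..2 * pi} (\<lambda>t. (r1 t)\<^sup>2) - 4 * integral {0..2 * pi} (\<lambda>t. (r t)\<^sup>2) = 0"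
    using has_integral_unique by blast
  then show "energy = 24 * deficit"
    using r.energy_identity D E by (simp add: r2 r3)
  show "deficit = 0" if "a2 = 0" "b2 = 0"
    using D that by (simp add: r r1)
qed

end

section \<open>Application to Legendre curves in the normal angle parametrization\<close>

theorem theorem5p4:
  fixes \<gamma> \<nu> :: "real \<Rightarrow> real^2"
  assumes "ell_convex \<gamma> \<nu>"
    and "normal_angle_param \<nu>"
  defines "p \<equiv> support_fun \<gamma> \<nu>"
    and "L \<equiv> alg_length \<gamma> \<nu>"
    and "A \<equiv> alg_area \<gamma> \<nu>"
    and "E \<equiv> integral {0..2*pi} (\<lambda>\<theta>. (deriv (curv_beta \<gamma> \<nu>) \<theta>)\<^sup>2)"
  shows "(\<forall>\<xi>\<le>24. E \<ge> \<xi> * (L\<^sup>2 / (4 * pi) - A) \<and>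
            (is_circle \<gamma> \<nu> \<longrightarrow> E = \<xi> * (L\<^sup>2 / (4 * pi) - A))) \<and>
         (\<forall>\<xi><24. E = \<xi> * (L\<^sup>2 / (4 * pi) - A) \<longrightarrow> is_circle \<gamma> \<nu>) \<and>
         (E = 24 * (L\<^sup>2 / (4 * pi) - A) \<longleftrightarrow>
            (\<exists>a0 a1 b1 a2 b2. \<forall>\<theta>. p \<theta> = a0 + a1 * cos \<theta> + b1 * sin \<theta>
                                        + a2 * cos (2 * \<theta>) + b2 * sin (2 * \<theta>)))"
proof -
  have leg: "legendre_curve \<gamma> \<nu>"
    using assms(1) by (simp add: ell_convex_def)
  note normal = assms(2)
  have nu: "\<nu> = (\<lambda>\<theta>. vector [cos \<theta>, sin \<theta>])"
    using normal by (auto simp: normal_angle_param_def)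
  define \<beta> where "\<beta> = curv_beta \<gamma> \<nu>"
  define \<gamma>1 where "\<gamma>1 t = vector_derivative \<gamma> (at t)" for t
  define \<gamma>2 where "\<gamma>2 t = vector_derivative \<gamma>1 (at t)" for t
  \<comment> \<open>The derivative of \<beta> = - \<gamma>1' sin + \<gamma>2' cos in coordinates;
    its continuity rests on that of the second derivative of \<gamma>.\<close>
  define \<beta>1 where "\<beta>1 t = - (\<gamma>2 t $ 1) * sin t - \<gamma>1 t $ 1 * cos t
    + (\<gamma>2 t $ 2) * cos t - \<gamma>1 t $ 2 * sin t" for t
  have smooth: "((\<lambda>g s. vector_derivative g (at s)) ^^ n) \<gamma> differentiable (at t)" for n t
    using leg by (simp add: legendre_curve_def circle_map_def smooth_fun_def)
  have g2: "(\<gamma>1 has_vector_derivative \<gamma>2 t) (at t)" for t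
    using smooth[of 1 t] by (simp add: vector_derivative_works \<gamma>1_def[abs_def] \<gamma>2_def)
  have "\<gamma>2 differentiable (at t)" for t
    using smooth[of 2 t] by (simp add: numeral_2_eq_2 \<gamma>1_def[abs_def] \<gamma>2_def[abs_def])
  then have c2: "continuous_on UNIV \<gamma>2"
    by (simp add: differentiable_imp_continuous_within continuous_at_imp_continuous_on)
  have c1: "continuous_on UNIV \<gamma>1"
    using g2 by (meson has_vector_derivative_continuous continuous_at_imp_continuous_on)
  have comp: "((\<lambda>t. \<gamma>1 t $ i) has_real_derivative \<gamma>2 t $ i) (at t)" for i t
    unfolding has_real_derivative_iff_has_vector_derivative
    using bounded_linear.has_vector_derivative[OF bounded_linear_vec_nth g2] .
  have beta: "\<beta> = (\<lambda>t. - \<gamma>1 t $ 1 * sin t + \<gamma>1 t $ 2 * cos t)"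
    by (simp add: fun_eq_iff \<beta>_def curv_beta_def rot90_def nu \<gamma>1_def inner_vec_def sum_2)
  have dbeta: "(\<beta> has_real_derivative \<beta>1 t) (at t)" for t
    unfolding beta \<beta>1_def by (rule derivative_eq_intros comp refl)+ simp
  have cbeta1: "continuous_on UNIV \<beta>1"
    unfolding \<beta>1_def[abs_def] by (intro continuous_intros c1 c2)
  have cbeta: "continuous_on UNIV \<beta>"
    using dbeta by (meson DERIV_isCont continuous_at_imp_continuous_on)
  have d0: "(p has_real_derivative deriv p t) (at t)" for t
    using support_fun_deriv[OF leg normal, of t] DERIV_imp_deriv unfolding p_def by metis
  have d1: "(deriv p has_real_derivative \<beta> t - p t) (at t)" for t
    using support_fun_deriv2[OF leg normal, of t] unfolding p_def \<beta>_def .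
  \<comment> \<open>From \<beta> = p + p'' the higher derivatives are read off as p'' = \<beta> - p
    and p''' = \<beta>' - p'. Hence \<open>p.energy\<close> is the integral of \<beta>'^2.\<close>
  interpret p: periodic_C3 p "deriv p" "\<lambda>t. \<beta> t - p t" "\<lambda>t. \<beta>1 t - deriv p t"
  proof
    show "((\<lambda>t. \<beta> t - p t) has_real_derivative \<beta>1 t - deriv p t) (at t)" for t
      by (intro derivative_intros dbeta d0)
    have "continuous_on UNIV (deriv p)"
      using d1 by (meson DERIV_isCont continuous_at_imp_continuous_on)
    then show "continuous_on UNIV (\<lambda>t. \<beta>1 t - deriv p t)"
      by (intro continuous_intros cbeta1)
    show "p (t + 2 * pi) = p t" for t
      using leg by (simp add: p_def support_fun_def legendre_curve_def circle_map_def)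
  qed (rule d0 d1)+
  have D: "L\<^sup>2 / (4 * pi) - A = p.deficit"
    using DERIV_imp_deriv[OF d1]
    by (simp add: L_def A_def alg_length_def alg_area_def p.deficit_def flip: p_def)
  have E: "E = p.energy"
    using DERIV_imp_deriv[OF dbeta] by (simp add: E_def p.energy_def flip: \<beta>_def)
  have circle: "is_circle \<gamma> \<nu> \<longleftrightarrow> (\<exists>a0 a1 b1. \<forall>\<theta>. p \<theta> = a0 + a1 * cos \<theta> + b1 * sin \<theta>)"
    by (simp add: is_circle_def p_def)
  show ?thesis
    unfolding D E
  proof (intro conjI allI impI iffI)
    fix \<xi> :: real assume "\<xi> \<le> 24"
    then have "\<xi> * p.deficit \<le> 24 * p.deficit"
      by (intro mult_right_mono p.deficit_nonneg)
    then show "\<xi> * p.deficit \<le> p.energy"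
      using p.energy_ge by linarith
  next
    \<comment> \<open>A circle is the case a2 = b2 = 0 of the second-mode form; the deficit is then
      0, hence so is the energy, and both sides vanish.\<close>
    fix \<xi> assume "is_circle \<gamma> \<nu>"
    then obtain a0 a1 b1
      where "\<And>t. p t = a0 + a1 * cos t + b1 * sin t + 0 * cos (2 * t) + 0 * sin (2 * t)"
      by (auto simp: circle)
    from p.energy_eq_second_mode[OF this] show "p.energy = \<xi> * p.deficit"
      by simp
  next
    \<comment> \<open>The equality together with the bound for 24 leaves (24 - \<xi>) times the
      deficit nonpositive, so the rigidity statement for vanishing deficit applies.\<close>
    fix \<xi> :: real assume "\<xi> < 24" "p.energy = \<xi> * p.deficit"
    then have "(24 - \<xi>) * p.deficit \<le> 0"
      using p.energy_ge by (simp add: algebra_simps)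
    then have "p.deficit \<le> 0"
      using \<open>\<xi> < 24\<close> by (simp add: mult_le_0_iff)
    then show "is_circle \<gamma> \<nu>"
      using p.deficit_eq_0 by (simp add: circle)
  next
    assume "p.energy = 24 * p.deficit"
    then show "\<exists>a0 a1 b1 a2 b2. \<forall>\<theta>. p \<theta> = a0 + a1 * cos \<theta> + b1 * sin \<theta>
        + a2 * cos (2 * \<theta>) + b2 * sin (2 * \<theta>)"
      by (rule p.energy_eq_imp)
  next
    assume "\<exists>a0 a1 b1 a2 b2. \<forall>\<theta>. p \<theta> = a0 + a1 * cos \<theta> + b1 * sin \<theta>
        + a2 * cos (2 * \<theta>) + b2 * sin (2 * \<theta>)"
    then show "p.energy = 24 * p.deficit"
      using p.energy_eq_second_mode(1) by blast
  qed
qed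

end
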